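(* Let $T$ be an in-quadrangular tournament and let $v\in V(T)$. Let $W$ be the subtournament of $T$ induced on the vertex set $I(v)$. Then $W$ contains no vertex of in-degree $1$ (in-degree computed in $W$).
   Context: A tournament $T$ is a loopless digraph in which for each pair of distinct vertices exactly one of $(u,v)$, $(v,u)$ is an arc; $u\rightarrow v$ means $(u,v)$ is an arc. $I(v)=\{u:u\rightarrow v\}$. A digraph is in-quadrangular if $|I(u)\cap I(v)|\neq 1$ for all distinct vertices $u,v$. *)

theory Defs
  imports "Graph_Theory.Digraph_Component"
begin

(* Finiteness is not part of the definition. Arc sets of digraphs are sets of ordered
   pairs, hence no parallel arcs. *)
locale tournament = loopfree_digraph + nomulti_digraph +
  assumes exactly_one_arc:
    "\<lbrakk>u \<in> verts G; v \<in> verts G; u \<noteq> v\<rbrakk> \<Longrightarrow> (u \<rightarrow>\<^bsub>G\<^esub> v) \<noteq> (v \<rightarrow>\<^bsub>G\<^esub> u)"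

definition in_nbhd :: "('a, 'b) pre_digraph \<Rightarrow> 'a \<Rightarrow> 'a set" where
  "in_nbhd G v = {u \<in> verts G. u \<rightarrow>\<^bsub>G\<^esub> v}"

(* card is 0 on infinite sets, so "card A = 1" means exactly that A is a singleton,
   also when in-neighbourhoods are infinite. *)
definition in_quadrangular :: "('a, 'b) pre_digraph \<Rightarrow> bool" where
  "in_quadrangular G \<longleftrightarrow>
    (\<forall>u \<in> verts G. \<forall>v \<in> verts G. u \<noteq> v \<longrightarrow> card (in_nbhd G u \<inter> in_nbhd G v) \<noteq> 1)"

end

theory Submission
  imports Defs
begin

lemma dominates_induce_subgraph_iff:
  "u \<rightarrow>\<^bsub>G \<restriction> S\<^esub> v \<longleftrightarrow> u \<in> S \<and> v \<in> S \<and> u \<rightarrow>\<^bsub>G\<^esub> v"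
  by (auto simp: arcs_ends_conv)

lemma (in loopfree_digraph) not_mem_in_nbhd_self: "v \<notin> in_nbhd G v"
  by (auto simp: in_nbhd_def dest: adj_not_same)

lemma (in wf_digraph) in_nbhd_induce_subgraph:
  assumes "v \<in> S"
  shows "in_nbhd (G \<restriction> S) v = in_nbhd G v \<inter> S"
  using assms by (auto simp: in_nbhd_def dominates_induce_subgraph_iff adj_in_verts)

lemma (in wf_digraph) tail_image_in_arcs: "tail G ` in_arcs G v = in_nbhd G v"
  by (auto simp: in_nbhd_def arcs_ends_conv)

lemma (in nomulti_digraph) inj_on_tail_in_arcs: "inj_on (tail G) (in_arcs G v)"
  by (auto intro!: inj_onI no_multi_arcs simp: arc_to_ends_def)

lemma (in nomulti_digraph) in_degree_eq_card_in_nbhd: "in_degree G v = card (in_nbhd G v)"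
  using card_image[OF inj_on_tail_in_arcs] by (simp add: in_degree_def tail_image_in_arcs)

lemma (in nomulti_digraph) nomulti_digraph_induce_subgraph: "nomulti_digraph (G \<restriction> S)"
proof -
  interpret induced: wf_digraph "G \<restriction> S" by (rule wellformed_induce_subgraph)
  show ?thesis by unfold_locales (auto intro: no_multi_arcs simp: arc_to_ends_def)
qed

lemma (in nomulti_digraph) in_degree_induce_subgraph:
  assumes "v \<in> S"
  shows "in_degree (G \<restriction> S) v = card (in_nbhd G v \<inter> S)"
proof -
  interpret induced: nomulti_digraph "G \<restriction> S" by (rule nomulti_digraph_induce_subgraph)
  show ?thesis
    using assms by (simp add: induced.in_degree_eq_card_in_nbhd in_nbhd_induce_subgraph)
qed

theorem theorem10:
  fixes T W :: "('a, 'b) pre_digraph" and v :: 'a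
  assumes "tournament T"
    and "in_quadrangular T"
    and "v \<in> verts T"
    and "W = T \<restriction> in_nbhd T v"
  shows "\<not> (\<exists>w \<in> verts W. in_degree W w = 1)"
proof -
  interpret tournament T by fact
  have "in_degree W w \<noteq> 1" if "w \<in> verts W" for w
  proof -
    have w_nbhd: "w \<in> in_nbhd T v"
      using that \<open>W = T \<restriction> in_nbhd T v\<close> by simp
    then have "in_degree W w = card (in_nbhd T w \<inter> in_nbhd T v)"
      using \<open>W = T \<restriction> in_nbhd T v\<close> by (simp add: in_degree_induce_subgraph)
    moreover have "w \<in> verts T" "w \<noteq> v"
      using w_nbhd not_mem_in_nbhd_self by (auto simp: in_nbhd_def)
    ultimately show ?thesis
      using \<open>in_quadrangular T\<close> \<open>v \<in> verts T\<close> by (simp add: in_quadrangular_def)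
  qed
  then show ?thesis by blast
qed

end
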